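(* Let $\mathbb{F}=\mathbb{R}$ or $\mathbb{F}=\mathbb{C}$. For an arbitrary $w\in\mathbb{F}$ with $|w|>1$, the bounded linear weighted backward shift operator \[ c_0(\mathbb{N})\ni x=(x_k)_{k\in\mathbb{N}}\mapsto A_wx:=w\,(x_{k+1})_{k\in\mathbb{N}}\in c_0(\mathbb{N}) \] on the space $c_0(\mathbb{N})$ is chaotic, as well as its every power $A_w^n$, $n\in\mathbb{N}$, and, provided the underlying space is complex (i.e., $\mathbb{F}=\mathbb{C}$), \[ \sigma(A_w)=\{\lambda\in\mathbb{C} : |\lambda|\le |w|\} \] with \[ \sigma_p(A_w)=\{\lambda\in\mathbb{C} : |\lambda|<|w|\}\quad\text{and}\quad \sigma_c(A_w)=\{\lambda\in\mathbb{C} : |\lambda|=|w|\}. \]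
   Context: $\mathbb{N}=\{1,2,3,\dots\}$, $\mathbb{Z}_+=\{0,1,2,\dots\}$. $c_0(\mathbb{N})$ is the Banach space of $\mathbb{F}$-valued sequences $(x_k)_{k\in\mathbb{N}}$ with $\lim_{k\to\infty}x_k=0$, with the norm $\|x\|_\infty=\sup_{k\in\mathbb{N}}|x_k|$. For a (bounded or unbounded) linear operator $A$ with domain $D(A)$ in a real or complex Banach space $X$, put $A^0:=I$ and $C^\infty(A):=\bigcap_{n=0}^\infty D(A^n)$. A nonzero vector $x\in C^\infty(A)$ is hypercyclic for $A$ if its orbit $\{A^nx\}_{n\in\mathbb{Z}_+}$ is dense in $X$; $A$ is hypercyclic if it possesses a hypercyclic vector. A vector $x\in D(A^N)$ with $A^Nx=x$ for some $N\in\mathbb{N}$ is a periodic point of $A$. $A$ is chaotic if it is hypercyclic and the set of its periodic points is dense in $X$. For a closed linear operator $A$ in a complex Banach space $X$, the spectrum $\sigma(A)$ is the disjoint union of the point spectrum $\sigma_p(A)$ (those $\lambda\in\mathbb{C}$ for which $A-\lambda I$ is not injective), the continuous spectrum $\sigma_c(A)$ (those $\lambda$ for which $A-\lambda I$ is injective, not surjective, and has range dense in $X$), and the residual spectrum $\sigma_r(A)$ (those $\lambda$ for which $A-\lambda I$ is injective and its range is not dense in $X$). *)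

theory Defs
  imports "HOL-Analysis.Analysis"
begin

section \<open>The Banach space of null sequences\<close>

text \<open>
  Sequences are indexed by \<open>nat\<close>, so the entry at index \<open>k\<close> is the mathematical entry
  with index \<open>k + 1\<close> of a sequence indexed by the positive integers.
\<close>

typedef (overloaded) 'a c0 = "{x :: nat \<Rightarrow> 'a::real_normed_vector. x \<longlonglongrightarrow> 0}"
  morphisms c0_nth Abs_c0
  by (rule exI[of _ "\<lambda>_. 0"]) simp

setup_lifting type_definition_c0

lemma c0_eqI: "(\<And>k. c0_nth x k = c0_nth y k) \<Longrightarrow> x = y"
  by (auto simp flip: c0_nth_inject)

lemma c0_nth_tendsto: "c0_nth x \<longlonglongrightarrow> 0"
  using c0_nth[of x] by simp

lemma bdd_above_c0: "bdd_above (range (\<lambda>k. norm (c0_nth x k)))"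
proof -
  have "Bseq (c0_nth x)"
    using c0_nth_tendsto convergentI convergent_imp_Bseq by blast
  then show ?thesis
    unfolding Bseq_def bdd_above_def by blast
qed

instantiation c0 :: (real_normed_vector) real_vector
begin

lift_definition zero_c0 :: "'a c0" is "\<lambda>_. 0" by simp

lift_definition plus_c0 :: "'a c0 \<Rightarrow> 'a c0 \<Rightarrow> 'a c0" is "\<lambda>x y k. x k + y k"
  by (auto intro: tendsto_add_zero)

lift_definition uminus_c0 :: "'a c0 \<Rightarrow> 'a c0" is "\<lambda>x k. - x k"
  using tendsto_minus by fastforce

lift_definition minus_c0 :: "'a c0 \<Rightarrow> 'a c0 \<Rightarrow> 'a c0" is "\<lambda>x y k. x k - y k"
  using tendsto_diff by fastforce

lift_definition scaleR_c0 :: "real \<Rightarrow> 'a c0 \<Rightarrow> 'a c0" is "\<lambda>r x k. r *\<^sub>R x k"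
  using tendsto_scaleR[OF tendsto_const] by fastforce

instance
  by standard (transfer; simp add: algebra_simps)+

end

instantiation c0 :: (real_normed_vector) real_normed_vector
begin

definition norm_c0 :: "'a c0 \<Rightarrow> real"
  where "norm_c0 x = (SUP k. norm (c0_nth x k))"

definition dist_c0 :: "'a c0 \<Rightarrow> 'a c0 \<Rightarrow> real"
  where "dist_c0 x y = norm (x - y)"

definition sgn_c0 :: "'a c0 \<Rightarrow> 'a c0"
  where "sgn_c0 x = x /\<^sub>R norm x"

definition uniformity_c0 :: "('a c0 \<times> 'a c0) filter"
  where "uniformity_c0 = (INF e\<in>{0<..}. principal {(x, y). dist x y < e})"

definition open_c0 :: "'a c0 set \<Rightarrow> bool"
  where "open_c0 U \<longleftrightarrow> (\<forall>x\<in>U. \<forall>\<^sub>F (x', y) in uniformity. x' = x \<longrightarrow> y \<in> U)"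

lemma norm_c0_nth_le: "norm (c0_nth x k) \<le> norm x"
  unfolding norm_c0_def by (intro cSUP_upper bdd_above_c0) simp

lemma norm_c0_leI: "(\<And>k. norm (c0_nth x k) \<le> B) \<Longrightarrow> norm x \<le> B"
  unfolding norm_c0_def by (rule cSUP_least) auto

instance
proof
  fix x y :: "'a c0" and r :: real
  show "norm x = 0 \<longleftrightarrow> x = 0"
  proof
    assume "norm x = 0"
    then show "x = 0"
      using norm_c0_nth_le[of x] by (intro c0_eqI) (simp add: zero_c0.rep_eq)
  next
    assume "x = 0"
    then show "norm x = 0"
      by (simp add: norm_c0_def zero_c0.rep_eq)
  qed
  show "norm (x + y) \<le> norm x + norm y"
    by (rule norm_c0_leI) (auto simp: plus_c0.rep_eq intro: norm_triangle_mono norm_c0_nth_le)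
  have le: "norm (r *\<^sub>R x) \<le> \<bar>r\<bar> * norm x" for r and x :: "'a c0"
    by (rule norm_c0_leI) (simp add: scaleR_c0.rep_eq mult_left_mono norm_c0_nth_le)
  show "norm (r *\<^sub>R x) = \<bar>r\<bar> * norm x"
  proof (cases "r = 0")
    case True
    then show ?thesis by (simp add: norm_c0_def zero_c0.rep_eq)
  next
    case False
    have "\<bar>r\<bar> * norm x = \<bar>r\<bar> * norm (inverse r *\<^sub>R r *\<^sub>R x)"
      using False by simp
    also have "\<dots> \<le> \<bar>r\<bar> * (\<bar>inverse r\<bar> * norm (r *\<^sub>R x))"
      by (intro mult_left_mono le) simp
    also have "\<dots> = norm (r *\<^sub>R x)"
      using False by simp
    finally show ?thesis
      using le[of r x] by simp
  qed
qed (rule dist_c0_def sgn_c0_def uniformity_c0_def open_c0_def)+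

end

instance c0 :: (banach) banach
proof
  fix X :: "nat \<Rightarrow> 'a c0"
  assume X: "Cauchy X"
  have diff: "norm (c0_nth (X m) k - c0_nth (X n) k) \<le> dist (X m) (X n)" for m n k
    using norm_c0_nth_le[of "X m - X n" k] by (simp add: dist_norm minus_c0.rep_eq)
  have "Cauchy (\<lambda>n. c0_nth (X n) k)" for k
  proof (rule metric_CauchyI)
    fix e :: real assume "e > 0"
    then obtain N where N: "\<And>m n. m \<ge> N \<Longrightarrow> n \<ge> N \<Longrightarrow> dist (X m) (X n) < e"
      using metric_CauchyD[OF X] by blast
    show "\<exists>N. \<forall>m\<ge>N. \<forall>n\<ge>N. dist (c0_nth (X m) k) (c0_nth (X n) k) < e"
      using le_less_trans[OF diff N] by (auto simp: dist_norm[where 'a = 'a])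
  qed
  then have "convergent (\<lambda>n. c0_nth (X n) k)" for k
    by (rule Cauchy_convergent)
  then obtain l where l: "\<And>k. (\<lambda>n. c0_nth (X n) k) \<longlonglongrightarrow> l k"
    unfolding convergent_def by metis
  have unif: "\<exists>N. \<forall>n\<ge>N. \<forall>k. norm (c0_nth (X n) k - l k) \<le> e" if "e > 0" for e
  proof -
    obtain N where N: "\<And>m n. m \<ge> N \<Longrightarrow> n \<ge> N \<Longrightarrow> dist (X m) (X n) < e"
      using metric_CauchyD[OF X \<open>e > 0\<close>] by blast
    have "norm (c0_nth (X n) k - l k) \<le> e" if "n \<ge> N" for n k
    proof (rule LIMSEQ_le_const2)
      show "(\<lambda>m. norm (c0_nth (X n) k - c0_nth (X m) k)) \<longlonglongrightarrow> norm (c0_nth (X n) k - l k)"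
        by (intro tendsto_intros l)
      show "\<exists>M. \<forall>m\<ge>M. norm (c0_nth (X n) k - c0_nth (X m) k) \<le> e"
        using less_imp_le[OF le_less_trans[OF diff N[OF that]]] by blast
    qed
    then show ?thesis by blast
  qed
  have "l \<longlonglongrightarrow> 0"
  proof (rule LIMSEQ_I)
    fix e :: real assume "e > 0"
    then obtain N where N: "\<And>k. norm (c0_nth (X N) k - l k) \<le> e / 2"
      using unif[of "e / 2"] by auto
    obtain K where K: "\<And>k. k \<ge> K \<Longrightarrow> norm (c0_nth (X N) k) < e / 2"
      using LIMSEQ_D[OF c0_nth_tendsto, of "e / 2" "X N"] \<open>e > 0\<close> by auto
    have "norm (l k - 0) < e" if "k \<ge> K" for k
      using N[of k] K[OF that] norm_triangle_ineq4[of "c0_nth (X N) k" "c0_nth (X N) k - l k"]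
      by simp
    then show "\<exists>K. \<forall>k\<ge>K. norm (l k - 0) < e" by blast
  qed
  then have nth_l: "c0_nth (Abs_c0 l) = l"
    by (simp add: Abs_c0_inverse)
  have "X \<longlonglongrightarrow> Abs_c0 l"
  proof (rule LIMSEQ_I)
    fix e :: real assume "e > 0"
    then obtain N where N: "\<And>n k. n \<ge> N \<Longrightarrow> norm (c0_nth (X n) k - l k) \<le> e / 2"
      using unif[of "e / 2"] by auto
    have "norm (X n - Abs_c0 l) \<le> e / 2" if "n \<ge> N" for n
      using N[OF that] by (intro norm_c0_leI) (simp add: minus_c0.rep_eq nth_l)
    then show "\<exists>N. \<forall>n\<ge>N. norm (X n - Abs_c0 l) < e"
      using \<open>e > 0\<close> by (intro exI[of _ N]) fastforce
  qed
  then show "convergent X"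
    by (rule convergentI)
qed

text \<open>
  Multiplication by scalars of the underlying field; for \<open>complex\<close> entries this is the complex
  vector space structure, which the class \<open>banach\<close> does not provide.
\<close>

lift_definition c0_scale :: "'a \<Rightarrow> 'a c0 \<Rightarrow> 'a::real_normed_field c0" is "\<lambda>a x k. a * x k"
  by (auto intro: tendsto_mult_right_zero)

lemma norm_c0_scale_le: "norm (c0_scale a x) \<le> norm a * norm x"
  by (rule norm_c0_leI) (simp add: c0_scale.rep_eq norm_mult mult_left_mono norm_c0_nth_le)

lemma vector_space_c0_scale: "vector_space c0_scale"
  by standard (transfer; simp add: algebra_simps)+

lemma c0_scale_of_real: "c0_scale (of_real r) x = r *\<^sub>R x"
  by transfer (simp add: scaleR_conv_of_real)


section \<open>Hypercyclic and chaotic operators\<close>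

text \<open>
  An operator with domain \<open>D\<close> is given by \<open>D\<close> and a total function \<open>A\<close>, of which only
  the values on \<open>D\<close> are used.
\<close>

primrec pow_domain :: "'x set \<Rightarrow> ('x \<Rightarrow> 'x) \<Rightarrow> nat \<Rightarrow> 'x set" where
  "pow_domain D A 0 = UNIV"
| "pow_domain D A (Suc n) = {x \<in> D. A x \<in> pow_domain D A n}"

definition C_infinity :: "'x set \<Rightarrow> ('x \<Rightarrow> 'x) \<Rightarrow> 'x set"
  where "C_infinity D A = (\<Inter>n. pow_domain D A n)"

definition hypercyclic_vector :: "'x::banach set \<Rightarrow> ('x \<Rightarrow> 'x) \<Rightarrow> 'x \<Rightarrow> bool"
  where "hypercyclic_vector D A x \<longleftrightarrow>
    x \<noteq> 0 \<and> x \<in> C_infinity D A \<and> closure (range (\<lambda>n. (A ^^ n) x)) = UNIV"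

definition hypercyclic :: "'x::banach set \<Rightarrow> ('x \<Rightarrow> 'x) \<Rightarrow> bool"
  where "hypercyclic D A \<longleftrightarrow> (\<exists>x. hypercyclic_vector D A x)"

definition periodic_points :: "'x set \<Rightarrow> ('x \<Rightarrow> 'x) \<Rightarrow> 'x set"
  where "periodic_points D A = {x. \<exists>N\<ge>1. x \<in> pow_domain D A N \<and> (A ^^ N) x = x}"

definition chaotic :: "'x::banach set \<Rightarrow> ('x \<Rightarrow> 'x) \<Rightarrow> bool"
  where "chaotic D A \<longleftrightarrow> hypercyclic D A \<and> closure (periodic_points D A) = UNIV"


section \<open>The spectrum and its parts\<close>

text \<open>
  The parameter \<open>smul\<close> is the complex scalar multiplication of the space.
\<close>

definition minus_scalar :: "(complex \<Rightarrow> 'x \<Rightarrow> 'x) \<Rightarrow> ('x \<Rightarrow> 'x) \<Rightarrow> complex \<Rightarrow> 'x::banach \<Rightarrow> 'x"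
  where "minus_scalar smul A \<mu> x = A x - smul \<mu> x"

definition point_spectrum ::
  "(complex \<Rightarrow> 'x \<Rightarrow> 'x) \<Rightarrow> 'x::banach set \<Rightarrow> ('x \<Rightarrow> 'x) \<Rightarrow> complex set"
  where "point_spectrum smul D A = {\<mu>. \<not> inj_on (minus_scalar smul A \<mu>) D}"

definition continuous_spectrum ::
  "(complex \<Rightarrow> 'x \<Rightarrow> 'x) \<Rightarrow> 'x::banach set \<Rightarrow> ('x \<Rightarrow> 'x) \<Rightarrow> complex set"
  where "continuous_spectrum smul D A =
    {\<mu>. inj_on (minus_scalar smul A \<mu>) D \<and> minus_scalar smul A \<mu> ` D \<noteq> UNIV \<and>
        closure (minus_scalar smul A \<mu> ` D) = UNIV}"

definition residual_spectrum ::
  "(complex \<Rightarrow> 'x \<Rightarrow> 'x) \<Rightarrow> 'x::banach set \<Rightarrow> ('x \<Rightarrow> 'x) \<Rightarrow> complex set"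
  where "residual_spectrum smul D A =
    {\<mu>. inj_on (minus_scalar smul A \<mu>) D \<and> closure (minus_scalar smul A \<mu> ` D) \<noteq> UNIV}"

definition spectrum ::
  "(complex \<Rightarrow> 'x \<Rightarrow> 'x) \<Rightarrow> 'x::banach set \<Rightarrow> ('x \<Rightarrow> 'x) \<Rightarrow> complex set"
  where "spectrum smul D A =
    point_spectrum smul D A \<union> continuous_spectrum smul D A \<union> residual_spectrum smul D A"

lemma spectrum_parts_disjoint:
  "point_spectrum smul D A \<inter> continuous_spectrum smul D A = {}"
  "point_spectrum smul D A \<inter> residual_spectrum smul D A = {}"
  "continuous_spectrum smul D A \<inter> residual_spectrum smul D A = {}"
  by (auto simp: point_spectrum_def continuous_spectrum_def residual_spectrum_def)

text \<open>
  For a closed operator on a Banach space, bijectivity already makes the inverse bounded, so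
  the following is the complement of the resolvent set.
\<close>

lemma spectrum_eq_not_bij:
  "spectrum smul D A = {\<mu>. \<not> bij_betw (minus_scalar smul A \<mu>) D UNIV}"
  by (auto simp: spectrum_def point_spectrum_def continuous_spectrum_def residual_spectrum_def
      bij_betw_def)


section \<open>Weighted backward shifts\<close>

lift_definition backward_shift :: "'a \<Rightarrow> 'a c0 \<Rightarrow> 'a::real_normed_field c0"
  is "\<lambda>w x k. w * x (Suc k)"
  by (auto intro: tendsto_mult_right_zero LIMSEQ_Suc)

text \<open>Linearity is over the scalar field \<open>'a\<close>, not merely over the reals.\<close>

definition bounded_linear_operator :: "('a c0 \<Rightarrow> 'a::real_normed_field c0) \<Rightarrow> bool"
  where "bounded_linear_operator A \<longleftrightarrow>
    Vector_Spaces.linear c0_scale c0_scale A \<and> (\<exists>K. \<forall>x. norm (A x) \<le> K * norm x)"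

end

theory Submission
  imports Defs
begin

text \<open>
  Finitely supported sequences with entries in a dense set \<open>D\<close> of scalars are dense in the space
  of null sequences, so each density claim below need only be checked on them.

  Chaos rests on two facts about the shift \<open>A\<close> with \<open>norm w > 1\<close>: iterates of \<open>A\<close> eventually kill
  every finitely supported sequence, and \<open>A ^^ n\<close> has the right inverse ``move \<open>n\<close> places to the
  right and divide by \<open>w ^ n\<close>'', which tends to zero in norm. Hence, given a finitely supported
  \<open>u\<close> and any \<open>v\<close>, adding to \<open>u\<close> a tiny vector that lives far out gives a vector close to \<open>u\<close> that
  \<open>A ^^ n\<close> maps exactly to \<open>v\<close>, for all large \<open>n\<close> (lemma \<open>backward_shift_mixing\<close>). Because this
  holds for all large \<open>n\<close>, it holds along the multiples of any \<open>p \<ge> 1\<close>, and Birkhoff's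
  transitivity argument (lemma \<open>hypercyclic_if_transitive\<close>, an application of the Baire category
  theorem) provides a hypercyclic vector of \<open>A ^^ p\<close>. Repeating \<open>u\<close> with period \<open>N\<close>, each copy
  being divided by \<open>w ^ N\<close> once more than the preceding one, gives a fixed vector of \<open>A ^^ N\<close>
  that is close to \<open>u\<close> when \<open>N\<close> is large; so periodic points are dense as well.

  The spectrum is found separately in three regions. For \<open>norm \<mu> < norm w\<close> the geometric sequence
  \<open>(\<mu> / w) ^ k\<close> is an eigenvector. For \<open>norm \<mu> \<ge> norm w\<close> an eigenvector would have entries of
  nondecreasing modulus, which is impossible in a space of null sequences. For
  \<open>norm \<mu> > norm w\<close> the equation \<open>A x - \<mu> x = y\<close> is the fixed point equation of a contraction.
  On the circle \<open>norm \<mu> = norm w\<close> the range contains all finitely supported sequences and is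
  therefore dense, but solving the equation for the right-hand side \<open>(\<mu> / w) ^ k / (k + 1)\<close>
  would make the harmonic series converge.
\<close>


section \<open>Finitely supported sequences\<close>

lift_definition c0_of_list :: "'a::real_normed_vector list \<Rightarrow> 'a c0"
  is "\<lambda>xs k. if k < length xs then xs ! k else 0"
proof -
  fix xs :: "'a list"
  have "\<forall>\<^sub>F k in sequentially. (if k < length xs then xs ! k else 0) = 0"
    using eventually_ge_at_top[of "length xs"] by eventually_elim simp
  then show "(\<lambda>k. if k < length xs then xs ! k else 0) \<longlonglongrightarrow> 0"
    by (rule tendsto_eventually)
qed

lemma c0_of_list_dense:
  fixes D :: "'a::real_normed_vector set"
  assumes "closure D = UNIV"
  shows "closure (c0_of_list ` lists D) = UNIV"
proof -
  have "x \<in> closure (c0_of_list ` lists D)" for x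
    unfolding closure_approachable
  proof (intro allI impI)
    fix e :: real assume "e > 0"
    then obtain N where N: "\<And>k. k \<ge> N \<Longrightarrow> norm (c0_nth x k) < e / 2"
      using LIMSEQ_D[OF c0_nth_tendsto, of "e / 2" x] by auto
    have "e / 2 > 0"
      using \<open>e > 0\<close> by simp
    then have "\<exists>d\<in>D. dist d (c0_nth x k) < e / 2" for k
      using assms closure_approachable[of "c0_nth x k" D] by blast
    then obtain d where d: "\<And>k. d k \<in> D" "\<And>k. dist (d k) (c0_nth x k) < e / 2"
      by metis
    have "norm (c0_of_list (map d [0..<N]) - x) \<le> e / 2"
    proof (rule norm_c0_leI)
      fix k
      show "norm (c0_nth (c0_of_list (map d [0..<N]) - x) k) \<le> e / 2"
        using d(2)[of k] N[of k]
        by (cases "k < N") (auto simp: minus_c0.rep_eq c0_of_list.rep_eq dist_norm)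
    qed
    then have "dist (c0_of_list (map d [0..<N])) x < e"
      using \<open>e > 0\<close> by (simp add: dist_norm)
    moreover have "map d [0..<N] \<in> lists D"
      using d(1) by auto
    ultimately show "\<exists>y\<in>c0_of_list ` lists D. dist y x < e"
      by blast
  qed
  then show ?thesis by blast
qed

lemma range_c0_of_list_dense: "closure (range c0_of_list) = UNIV"
  using c0_of_list_dense[of UNIV] by (simp add: lists_UNIV)

lemma countable_dense_lists:
  obtains D :: "'a::{real_normed_vector,second_countable_topology} set"
  where "countable (c0_of_list ` lists D)" "closure (c0_of_list ` lists D) = UNIV"
proof -
  obtain D :: "'a set"
    where D: "countable D" "\<And>X. open X \<Longrightarrow> X \<noteq> {} \<Longrightarrow> \<exists>d\<in>D. d \<in> X"
    by (rule countable_dense_setE) blast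
  have "\<exists>d\<in>D. dist d x < e" if "e > 0" for x e
    using D(2)[of "ball x e"] that by (auto simp: dist_commute)
  then have "closure D = UNIV"
    by (auto simp: closure_approachable)
  with D(1) show ?thesis
    by (intro that[of D] c0_of_list_dense) auto
qed


section \<open>Existence of hypercyclic vectors\<close>

lemma pow_domain_UNIV: "pow_domain UNIV A n = UNIV"
  by (induction n) auto

text \<open>
  The vectors whose orbit meets a given ball around a point of \<open>Q\<close> form an open set, which is dense
  by the transitivity assumption. By the Baire category theorem the countable intersection of these sets
  over \<open>Q\<close> and the radii \<open>1 / (k + 1)\<close> is dense, so it contains a nonzero vector as soon as the
  space does.
\<close>

lemma hypercyclic_if_transitive:
  fixes T :: "'x::banach \<Rightarrow> 'x"
  assumes cont: "\<And>n. continuous_on UNIV (T ^^ n)"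
    and Q: "countable Q" "closure Q = UNIV"
    and nontrivial: "a \<noteq> (0::'x)"
    and trans: "\<And>u v e. u \<in> Q \<Longrightarrow> v \<in> Q \<Longrightarrow> e > 0 \<Longrightarrow>
      \<exists>n x. dist x u < e \<and> dist ((T ^^ n) x) v < e"
  shows "hypercyclic UNIV T"
proof -
  have approx: "\<exists>q\<in>Q. dist q v < e" if "e > 0" for v e
    using Q(2) that closure_approachable[of v Q] by simp
  define U where "U = (\<lambda>(q, k). \<Union>n. (T ^^ n) -` ball q (inverse (real (Suc k))))"
  define G where "G = U ` (Q \<times> UNIV)"
  have U_iff: "x \<in> U (q, k) \<longleftrightarrow> (\<exists>n. dist ((T ^^ n) x) q < inverse (real (Suc k)))" for x q k
    by (auto simp: U_def dist_commute)
  have open_U: "open (U (q, k))" for q k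
    unfolding U_def using cont by (auto intro!: open_UN open_vimage)
  have dense_U: "closure (U (q, k)) = UNIV" if "q \<in> Q" for q k
  proof -
    have "\<exists>y\<in>U (q, k). dist y x < e" if "e > 0" for x e
    proof -
      obtain u where u: "u \<in> Q" "dist u x < e / 2"
        using approx[of "e / 2" x] \<open>e > 0\<close> by auto
      have "min (e / 2) (inverse (real (Suc k))) > 0"
        using \<open>e > 0\<close> by simp
      from trans[OF u(1) \<open>q \<in> Q\<close> this] obtain n y
        where y: "dist y u < e / 2" "dist ((T ^^ n) y) q < inverse (real (Suc k))"
        by auto
      have "dist y x < e"
        using y(1) u(2) dist_triangle[of y x u] by linarith
      moreover have "y \<in> U (q, k)"
        using y(2) U_iff by blast
      ultimately show ?thesis by blast
    qed
    then show ?thesis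
      by (auto simp: closure_approachable)
  qed
  have "Met_TC.mtopology closure_of \<Inter>G = (UNIV :: 'x set)"
  proof (rule Met_TC.metric_Baire_category)
    show "Met_TC.mcomplete TYPE('x)"
      using complete_UNIV by simp
    show "countable G"
      unfolding G_def using Q(1) by simp
    show "openin Met_TC.mtopology S \<and> Met_TC.mtopology closure_of S = UNIV" if "S \<in> G" for S
      using that open_U dense_U unfolding G_def by auto
  qed
  then have dense_G: "closure (\<Inter>G) = UNIV"
    by simp
  have "\<not> \<Inter>G \<subseteq> {0}"
  proof
    assume "\<Inter>G \<subseteq> {0}"
    then have "closure (\<Inter>G) \<subseteq> {0}"
      by (intro closure_minimal) auto
    with dense_G nontrivial show False by auto
  qed
  then obtain x where x: "x \<in> \<Inter>G" "x \<noteq> 0" by blast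
  have "\<exists>y\<in>range (\<lambda>n. (T ^^ n) x). dist y v < e" if "e > 0" for v e
  proof -
    obtain q where q: "q \<in> Q" "dist q v < e / 2"
      using approx[of "e / 2" v] \<open>e > 0\<close> by auto
    obtain k where k: "inverse (real (Suc k)) < e / 2"
      using reals_Archimedean[of "e / 2"] \<open>e > 0\<close> by auto
    have "x \<in> U (q, k)"
      using x(1) q(1) unfolding G_def by blast
    then obtain n where "dist ((T ^^ n) x) q < inverse (real (Suc k))"
      unfolding U_iff by blast
    then have "dist ((T ^^ n) x) v < e"
      using k q(2) dist_triangle[of "(T ^^ n) x" v q] by linarith
    then show ?thesis by blast
  qed
  then have "closure (range (\<lambda>n. (T ^^ n) x)) = UNIV"
    by (auto simp: closure_approachable)
  with x(2) show ?thesis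
    unfolding hypercyclic_def hypercyclic_vector_def C_infinity_def
    by (auto simp: pow_domain_UNIV)
qed


section \<open>Iterates of the weighted backward shift\<close>

lemma c0_nth_backward_shift_funpow:
  "c0_nth ((backward_shift w ^^ n) x) k = w ^ n * c0_nth x (k + n)"
  by (induction n arbitrary: k) (simp_all add: backward_shift.rep_eq)

lemma backward_shift_funpow_add:
  "(backward_shift w ^^ n) (x + y) = (backward_shift w ^^ n) x + (backward_shift w ^^ n) y"
  by (rule c0_eqI) (simp add: c0_nth_backward_shift_funpow plus_c0.rep_eq distrib_left)

lemma backward_shift_funpow_diff:
  "(backward_shift w ^^ n) (x - y) = (backward_shift w ^^ n) x - (backward_shift w ^^ n) y"
  by (rule c0_eqI) (simp add: c0_nth_backward_shift_funpow minus_c0.rep_eq right_diff_distrib)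

lemma norm_backward_shift_funpow_le: "norm ((backward_shift w ^^ n) x) \<le> norm w ^ n * norm x"
  by (rule norm_c0_leI)
    (simp add: c0_nth_backward_shift_funpow norm_mult norm_power mult_left_mono norm_c0_nth_le)

lemma norm_backward_shift_le: "norm (backward_shift w x) \<le> norm w * norm x"
  using norm_backward_shift_funpow_le[of 1 w x] by simp

lemma backward_shift_add: "backward_shift w (x + y) = backward_shift w x + backward_shift w y"
  using backward_shift_funpow_add[of 1 w x y] by simp

lemma backward_shift_scale: "backward_shift w (c0_scale a x) = c0_scale a (backward_shift w x)"
  by transfer (simp add: ac_simps)

lemma bounded_linear_operator_backward_shift: "bounded_linear_operator (backward_shift w)"
  unfolding bounded_linear_operator_def Vector_Spaces.linear_iff
  using vector_space_c0_scale backward_shift_add backward_shift_scale norm_backward_shift_le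
  by blast

lemma continuous_on_backward_shift_funpow: "continuous_on S (backward_shift w ^^ n)"
proof (rule lipschitz_on_continuous_on)
  show "(norm w ^ n)-lipschitz_on S (backward_shift w ^^ n)"
    by (rule lipschitz_onI)
      (simp_all add: dist_norm norm_backward_shift_funpow_le flip: backward_shift_funpow_diff)
qed

lemma backward_shift_funpow_of_list_eq_0:
  assumes "length xs \<le> n"
  shows "(backward_shift w ^^ n) (c0_of_list xs) = 0"
  using assms
  by (intro c0_eqI) (simp add: c0_nth_backward_shift_funpow c0_of_list.rep_eq zero_c0.rep_eq)


section \<open>Chaos\<close>

lift_definition forward_shift :: "'a \<Rightarrow> nat \<Rightarrow> 'a c0 \<Rightarrow> 'a::real_normed_field c0"
  is "\<lambda>w n x k. if k < n then 0 else x (k - n) / w ^ n"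
proof -
  fix w :: 'a and n and x :: "nat \<Rightarrow> 'a"
  assume "x \<longlonglongrightarrow> 0"
  then have "(\<lambda>k. x k / w ^ n) \<longlonglongrightarrow> 0"
    unfolding divide_inverse by (rule tendsto_mult_left_zero)
  then have "(\<lambda>k. if k + n < n then 0 else x (k + n - n) / w ^ n) \<longlonglongrightarrow> 0"
    by simp
  then show "(\<lambda>k. if k < n then 0 else x (k - n) / w ^ n) \<longlonglongrightarrow> 0"
    by (rule LIMSEQ_offset[where k = n])
qed

lemma backward_shift_forward_shift:
  "w \<noteq> 0 \<Longrightarrow> (backward_shift w ^^ n) (forward_shift w n x) = x"
  by (rule c0_eqI) (simp add: c0_nth_backward_shift_funpow forward_shift.rep_eq)

lemma norm_forward_shift_le: "norm (forward_shift w n x) \<le> norm x / norm w ^ n"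
  by (rule norm_c0_leI)
    (simp add: forward_shift.rep_eq norm_divide norm_power divide_right_mono norm_c0_nth_le)

lemma eventually_divide_power_less:
  fixes r b e :: real
  assumes "r > 1" "e > 0"
  shows "\<forall>\<^sub>F n in sequentially. b / r ^ n < e"
proof -
  have "(\<lambda>n. b / r ^ n) \<longlonglongrightarrow> 0"
    using \<open>r > 1\<close> by (rule LIMSEQ_divide_realpow_zero)
  then show ?thesis
    using \<open>e > 0\<close> by (rule order_tendstoD)
qed

text \<open>
  The witness is \<open>u + forward_shift w n v\<close>: the iterate kills \<open>u\<close> and restores \<open>v\<close>.
\<close>

lemma backward_shift_mixing:
  fixes w :: "'a::real_normed_field"
  assumes "norm w > 1" "e > 0"
  shows "\<forall>\<^sub>F n in sequentially.
    \<exists>x. dist x (c0_of_list xs) < e \<and> (backward_shift w ^^ n) x = v"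
  using eventually_divide_power_less[OF assms, of "norm v"] eventually_ge_at_top[of "length xs"]
proof eventually_elim
  case (elim n)
  have "w \<noteq> 0"
    using assms(1) by auto
  let ?x = "c0_of_list xs + forward_shift w n v"
  have "dist ?x (c0_of_list xs) < e"
    using norm_forward_shift_le[of w n v] elim(1) by (simp add: dist_norm)
  moreover have "(backward_shift w ^^ n) ?x = v"
    using elim(2) \<open>w \<noteq> 0\<close>
    by (simp add: backward_shift_funpow_add backward_shift_funpow_of_list_eq_0
        backward_shift_forward_shift)
  ultimately show ?case by blast
qed

lemma funpow_funpow:
  fixes f :: "'x \<Rightarrow> 'x"
  shows "(f ^^ p) ^^ m = f ^^ (p * m)"
  by (simp add: funpow_mult mult.commute)

lemma hypercyclic_backward_shift_funpow:
  fixes w :: "'a::{real_normed_field,banach,second_countable_topology}"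
  assumes "norm w > 1" "p \<ge> 1"
  shows "hypercyclic UNIV (backward_shift w ^^ p)"
proof -
  obtain D :: "'a set"
    where D: "countable (c0_of_list ` lists D)" "closure (c0_of_list ` lists D) = UNIV"
    by (rule countable_dense_lists)
  show ?thesis
  proof (rule hypercyclic_if_transitive[OF _ D])
    show "continuous_on UNIV ((backward_shift w ^^ p) ^^ n)" for n
      unfolding funpow_funpow by (rule continuous_on_backward_shift_funpow)
    have "c0_nth (c0_of_list [1::'a]) 0 \<noteq> c0_nth 0 0"
      by (simp add: c0_of_list.rep_eq zero_c0.rep_eq)
    then show "c0_of_list [1::'a] \<noteq> 0" by auto
    fix u v :: "'a c0" and e :: real
    assume "u \<in> c0_of_list ` lists D" "e > 0"
    then obtain xs where u: "u = c0_of_list xs" by blast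
    obtain N where N: "\<And>n. n \<ge> N \<Longrightarrow> \<exists>x. dist x u < e \<and> (backward_shift w ^^ n) x = v"
      using backward_shift_mixing[OF assms(1) \<open>e > 0\<close>, of xs v]
      unfolding u eventually_sequentially by blast
    have "p * N \<ge> N"
      using assms(2) by simp
    from N[OF this] show "\<exists>n x. dist x u < e \<and> dist (((backward_shift w ^^ p) ^^ n) x) v < e"
      unfolding funpow_funpow using \<open>e > 0\<close> by (metis dist_self)
  qed
qed

text \<open>
  The \<open>j\<close>-th block of length \<open>N\<close> is the initial block of \<open>x\<close> divided by \<open>w ^ (N * j)\<close>, which is
  exactly what invariance under \<open>backward_shift w ^^ N\<close> requires. The guard makes
  the blocks shrink geometrically, so that a null sequence results.
\<close>

lift_definition periodic_extension :: "'a \<Rightarrow> nat \<Rightarrow> 'a c0 \<Rightarrow> 'a::real_normed_field c0"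
  is "\<lambda>w N x k. if norm w > 1 \<and> N \<ge> 1 then x (k mod N) / w ^ (N * (k div N)) else 0"
proof -
  fix w :: 'a and N and x :: "nat \<Rightarrow> 'a"
  assume "x \<longlonglongrightarrow> 0"
  then have "Bseq x"
    using convergentI convergent_imp_Bseq by blast
  then obtain B where B: "\<And>k. norm (x k) \<le> B"
    unfolding Bseq_def by blast
  show "(\<lambda>k. if norm w > 1 \<and> N \<ge> 1 then x (k mod N) / w ^ (N * (k div N)) else 0) \<longlonglongrightarrow> 0"
  proof (cases "norm w > 1 \<and> N \<ge> 1")
    case True
    then have "norm w ^ N > 1"
      by (simp add: one_less_power)
    then have "(\<lambda>j. B / (norm w ^ N) ^ j) \<longlonglongrightarrow> 0"
      by (rule LIMSEQ_divide_realpow_zero)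
    moreover have "filterlim (\<lambda>k. k div N) sequentially sequentially"
      using True by (intro filterlim_at_top_div_const_nat) auto
    ultimately have lim: "(\<lambda>k. B / (norm w ^ N) ^ (k div N)) \<longlonglongrightarrow> 0"
      by (rule filterlim_compose)
    have "(\<lambda>k. x (k mod N) / w ^ (N * (k div N))) \<longlonglongrightarrow> 0"
      by (rule Lim_null_comparison[OF _ lim])
        (simp add: norm_divide norm_power power_mult divide_right_mono B)
    with True show ?thesis by simp
  next
    case False
    then show ?thesis by (simp only: if_False tendsto_const)
  qed
qed

lemma periodic_extension_fixed:
  assumes "norm w > 1" "N \<ge> 1"
  shows "(backward_shift w ^^ N) (periodic_extension w N x) = periodic_extension w N x"
proof (rule c0_eqI)
  fix k
  have "w \<noteq> 0"
    using assms(1) by auto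
  have "(k + N) div N = Suc (k div N)"
    using assms(2) by simp
  then show "c0_nth ((backward_shift w ^^ N) (periodic_extension w N x)) k =
      c0_nth (periodic_extension w N x) k"
    using assms \<open>w \<noteq> 0\<close>
    by (simp add: c0_nth_backward_shift_funpow periodic_extension.rep_eq power_add)
qed

lemma dist_periodic_extension_le:
  assumes "norm w > 1" "N \<ge> 1" "length xs \<le> N"
  shows "dist (periodic_extension w N (c0_of_list xs)) (c0_of_list xs)
    \<le> norm (c0_of_list xs) / norm w ^ N"
  unfolding dist_norm
proof (rule norm_c0_leI)
  fix k
  let ?u = "c0_of_list xs"
  show "norm (c0_nth (periodic_extension w N ?u - ?u) k) \<le> norm ?u / norm w ^ N"
  proof (cases "k < N")
    case True
    then show ?thesis
      using assms by (simp add: minus_c0.rep_eq periodic_extension.rep_eq)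
  next
    case False
    then have "k div N \<ge> 1"
      using assms(2) by (simp add: Suc_le_eq div_greater_zero_iff)
    then have "N \<le> N * (k div N)"
      using assms(2) by simp
    have "c0_nth ?u k = 0"
      using False assms(3) by (simp add: c0_of_list.rep_eq)
    then have "norm (c0_nth (periodic_extension w N ?u - ?u) k)
        = norm (c0_nth ?u (k mod N)) / norm w ^ (N * (k div N))"
      using assms by (simp add: minus_c0.rep_eq periodic_extension.rep_eq norm_divide norm_power)
    also have "\<dots> \<le> norm ?u / norm w ^ N"
      using assms(1) \<open>N \<le> N * (k div N)\<close>
      by (intro frac_le norm_c0_nth_le power_increasing zero_less_power) auto
    finally show ?thesis .
  qed
qed

lemma periodic_points_backward_shift_dense:
  fixes w :: "'a::{real_normed_field,banach}"
  assumes "norm w > 1" "p \<ge> 1"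
  shows "closure (periodic_points UNIV (backward_shift w ^^ p)) = UNIV"
proof -
  let ?P = "periodic_points UNIV (backward_shift w ^^ p)"
  have "c0_of_list xs \<in> closure ?P" for xs :: "'a list"
    unfolding closure_approachable
  proof (intro allI impI)
    fix e :: real assume "e > 0"
    let ?u = "c0_of_list xs"
    obtain M where M: "\<And>n. n \<ge> M \<Longrightarrow> norm ?u / norm w ^ n < e"
      using eventually_divide_power_less[OF assms(1) \<open>e > 0\<close>, of "norm ?u"]
      unfolding eventually_sequentially by blast
    define m where "m = Suc (max M (length xs))"
    have "m \<le> p * m"
      using assms(2) by simp
    then have m: "m \<ge> 1" "p * m \<ge> 1" "p * m \<ge> M" "p * m \<ge> length xs"
      unfolding m_def by linarith+
    let ?y = "periodic_extension w (p * m) ?u"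
    have "((backward_shift w ^^ p) ^^ m) ?y = ?y"
      unfolding funpow_funpow using assms(1) m(2) by (rule periodic_extension_fixed)
    then have "?y \<in> ?P"
      using m(1) by (auto simp: periodic_points_def pow_domain_UNIV)
    moreover have "dist ?y ?u < e"
      using dist_periodic_extension_le[OF assms(1) m(2) m(4)] M[OF m(3)] by linarith
    ultimately show "\<exists>y\<in>?P. dist y ?u < e" by blast
  qed
  then have "closure (range (c0_of_list :: 'a list \<Rightarrow> 'a c0)) \<subseteq> closure ?P"
    by (intro closure_minimal) auto
  then show ?thesis
    using range_c0_of_list_dense by auto
qed

lemma chaotic_backward_shift_funpow:
  fixes w :: "'a::{real_normed_field,banach,second_countable_topology}"
  assumes "norm w > 1" "p \<ge> 1"
  shows "chaotic UNIV (backward_shift w ^^ p)"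
  unfolding chaotic_def
  using hypercyclic_backward_shift_funpow[OF assms] periodic_points_backward_shift_dense[OF assms]
  by blast

lemma chaotic_backward_shift:
  fixes w :: "'a::{real_normed_field,banach,second_countable_topology}"
  assumes "norm w > 1"
  shows "chaotic UNIV (backward_shift w)"
  using chaotic_backward_shift_funpow[OF assms, of 1] by simp


section \<open>The spectrum\<close>

abbreviation shift_minus :: "complex \<Rightarrow> complex \<Rightarrow> complex c0 \<Rightarrow> complex c0"
  where "shift_minus w \<mu> \<equiv> minus_scalar c0_scale (backward_shift w) \<mu>"

lemma c0_nth_shift_minus:
  "c0_nth (shift_minus w \<mu> x) k = w * c0_nth x (Suc k) - \<mu> * c0_nth x k"
  by (simp add: minus_scalar_def minus_c0.rep_eq backward_shift.rep_eq c0_scale.rep_eq)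

lemma shift_minus_diff: "shift_minus w \<mu> (x - y) = shift_minus w \<mu> x - shift_minus w \<mu> y"
  by (rule c0_eqI) (simp add: c0_nth_shift_minus minus_c0.rep_eq algebra_simps)

lemma shift_minus_scale: "shift_minus w \<mu> (c0_scale a x) = c0_scale a (shift_minus w \<mu> x)"
  by (rule c0_eqI) (simp add: c0_nth_shift_minus c0_scale.rep_eq algebra_simps)

lemma not_inj_shift_minus:
  assumes "norm \<mu> < norm w"
  shows "\<not> inj (shift_minus w \<mu>)"
proof
  assume inj: "inj (shift_minus w \<mu>)"
  have "w \<noteq> 0"
    using assms by auto
  define x where "x = Abs_c0 (\<lambda>k. (\<mu> / w) ^ k)"
  have "(\<lambda>k. (\<mu> / w) ^ k) \<longlonglongrightarrow> 0"
    using assms \<open>w \<noteq> 0\<close> by (intro LIMSEQ_power_zero) (simp add: norm_divide)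
  then have nth_x: "c0_nth x k = (\<mu> / w) ^ k" for k
    by (simp add: x_def Abs_c0_inverse)
  have "shift_minus w \<mu> x = shift_minus w \<mu> 0"
    using \<open>w \<noteq> 0\<close> by (intro c0_eqI) (simp add: c0_nth_shift_minus nth_x zero_c0.rep_eq)
  with inj have "x = 0"
    by (simp add: inj_eq)
  then show False
    using nth_x[of 0] by (simp add: zero_c0.rep_eq)
qed

lemma inj_shift_minus:
  assumes "w \<noteq> 0" "norm w \<le> norm \<mu>"
  shows "inj (shift_minus w \<mu>)"
proof (rule injI)
  fix x y
  assume "shift_minus w \<mu> x = shift_minus w \<mu> y"
  then have ker: "shift_minus w \<mu> (x - y) = 0"
    by (simp add: shift_minus_diff)
  define z where "z = c0_nth (x - y)"
  have "norm (z j) \<le> norm (z (Suc j))" for j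
  proof -
    have "w * z (Suc j) = \<mu> * z j"
      using arg_cong[OF ker, of "\<lambda>x. c0_nth x j"]
      by (simp add: c0_nth_shift_minus z_def zero_c0.rep_eq)
    then have "norm w * norm (z (Suc j)) = norm \<mu> * norm (z j)"
      by (metis norm_mult)
    also have "\<dots> \<ge> norm w * norm (z j)"
      using assms(2) by (rule mult_right_mono) simp
    finally show ?thesis
      using assms(1) by simp
  qed
  then have "incseq (\<lambda>k. norm (z k))"
    by (rule incseq_SucI)
  moreover have "(\<lambda>k. norm (z k)) \<longlonglongrightarrow> 0"
    unfolding z_def using c0_nth_tendsto by (rule tendsto_norm_zero)
  ultimately have "norm (z k) \<le> 0" for k
    by (rule incseq_le)
  then have "x - y = 0"
    by (intro c0_eqI) (simp add: z_def zero_c0.rep_eq)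
  then show "x = y" by simp
qed

text \<open>
  A solution of \<open>A x - \<mu> x = y\<close> is a fixed point of \<open>x \<mapsto> (A x - y) / \<mu>\<close>, a map with Lipschitz
  constant \<open>norm w / norm \<mu>\<close>.
\<close>

lemma surj_shift_minus:
  assumes "norm w < norm \<mu>"
  shows "surj (shift_minus w \<mu>)"
proof -
  have "\<mu> \<noteq> 0"
    using assms by auto
  have "\<exists>x. shift_minus w \<mu> x = y" for y
  proof -
    define f where "f x = c0_scale (inverse \<mu>) (backward_shift w x - y)" for x
    have f_diff: "f x - f x' = c0_scale (inverse \<mu>) (backward_shift w (x - x'))" for x x'
      unfolding f_def
      by (rule c0_eqI)
        (simp add: minus_c0.rep_eq c0_scale.rep_eq backward_shift.rep_eq algebra_simps)
    have "dist (f x) (f x') \<le> (norm w / norm \<mu>) * dist x x'" for x x'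
    proof -
      have "dist (f x) (f x') \<le> norm (inverse \<mu>) * norm (backward_shift w (x - x'))"
        unfolding dist_norm f_diff by (rule norm_c0_scale_le)
      also have "\<dots> \<le> norm (inverse \<mu>) * (norm w * norm (x - x'))"
        by (intro mult_left_mono norm_backward_shift_le) simp
      finally show ?thesis
        by (simp add: dist_norm norm_inverse divide_inverse mult_ac)
    qed
    moreover have "norm w / norm \<mu> < 1"
      using assms \<open>\<mu> \<noteq> 0\<close> by simp
    ultimately obtain x where "f x = x"
      using banach_fix_type[of "norm w / norm \<mu>" f] by auto
    then have "c0_nth (f x) k = c0_nth x k" for k
      by simp
    then have "shift_minus w \<mu> x = y"
      using \<open>\<mu> \<noteq> 0\<close>
      by (intro c0_eqI)
        (simp add: f_def c0_nth_shift_minus c0_scale.rep_eq minus_c0.rep_eq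
          backward_shift.rep_eq field_simps)
    then show ?thesis by blast
  qed
  then show ?thesis
    unfolding surj_def by (auto intro: sym)
qed

text \<open>
  Dropping the first entry of a finitely supported \<open>u\<close> gives \<open>A u\<close> up to a scalar. If
  \<open>A u = (A - \<mu>) x\<close>, then \<open>\<mu> u = A u - (A - \<mu>) u = (A - \<mu>) (x - u)\<close>, so \<open>u\<close> is in the range too.
\<close>

lemma c0_of_list_in_range_shift_minus:
  assumes "\<mu> \<noteq> 0"
  shows "c0_of_list xs \<in> range (shift_minus w \<mu>)"
proof (induction xs)
  case Nil
  have "c0_of_list [] = shift_minus w \<mu> 0"
    by (rule c0_eqI) (simp add: c0_nth_shift_minus c0_of_list.rep_eq zero_c0.rep_eq)
  then show ?case by blast
next
  case (Cons a xs)
  then obtain x where x: "c0_of_list xs = shift_minus w \<mu> x" by blast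
  let ?u = "c0_of_list (a # xs)"
  have "backward_shift w ?u = c0_scale w (c0_of_list xs)"
    by (rule c0_eqI) (simp add: backward_shift.rep_eq c0_scale.rep_eq c0_of_list.rep_eq)
  then have Au: "backward_shift w ?u = shift_minus w \<mu> (c0_scale w x)"
    by (simp add: x shift_minus_scale)
  have "c0_scale \<mu> ?u = backward_shift w ?u - shift_minus w \<mu> ?u"
    by (simp add: minus_scalar_def)
  then have "c0_scale \<mu> ?u = shift_minus w \<mu> (c0_scale w x - ?u)"
    by (simp add: Au shift_minus_diff)
  then have "shift_minus w \<mu> (c0_scale (inverse \<mu>) (c0_scale w x - ?u))
      = c0_scale (inverse \<mu>) (c0_scale \<mu> ?u)"
    by (simp add: shift_minus_scale)
  also have "\<dots> = ?u"
    using assms by (intro c0_eqI) (simp add: c0_scale.rep_eq)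
  finally show ?case by (metis rangeI)
qed

lemma range_shift_minus_dense:
  assumes "\<mu> \<noteq> 0"
  shows "closure (range (shift_minus w \<mu>)) = UNIV"
proof -
  have "range c0_of_list \<subseteq> range (shift_minus w \<mu>)"
    using c0_of_list_in_range_shift_minus[OF assms] by blast
  then show ?thesis
    using closure_mono range_c0_of_list_dense by blast
qed

text \<open>
  If \<open>x\<close> is a preimage of \<open>(\<mu> / w) ^ k / (k + 1)\<close>, the rotated entries \<open>z k = (w / \<mu>) ^ k * x k\<close>
  have increments \<open>1 / (\<mu> * (k + 1))\<close>. Rotation preserves moduli, so \<open>z\<close> is a null sequence, whereas
  it differs from the harmonic numbers only by a constant and the factor \<open>1 / \<mu>\<close>.
\<close>

lemma not_surj_shift_minus:
  assumes "w \<noteq> 0" "norm \<mu> = norm w"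
  shows "range (shift_minus w \<mu>) \<noteq> UNIV"
proof
  assume surj: "range (shift_minus w \<mu>) = UNIV"
  have "\<mu> \<noteq> 0"
    using assms by auto
  define y where "y = Abs_c0 (\<lambda>k. (\<mu> / w) ^ k * inverse (of_nat (Suc k)))"
  have "(\<lambda>k. norm (inverse (of_nat (Suc k) :: complex))) \<longlonglongrightarrow> 0"
    using LIMSEQ_inverse_real_of_nat by (simp add: norm_inverse del: of_nat_Suc)
  then have "(\<lambda>k. norm ((\<mu> / w) ^ k * inverse (of_nat (Suc k)))) \<longlonglongrightarrow> 0"
    using assms by (simp add: norm_mult norm_power norm_divide)
  then have "(\<lambda>k. (\<mu> / w) ^ k * inverse (of_nat (Suc k))) \<longlonglongrightarrow> 0"
    by (rule tendsto_norm_zero_cancel)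
  then have nth_y: "c0_nth y k = (\<mu> / w) ^ k * inverse (of_nat (Suc k))" for k
    by (simp add: y_def Abs_c0_inverse)
  obtain x where x: "shift_minus w \<mu> x = y"
    using surj by (metis UNIV_I imageE)
  define z where "z k = (w / \<mu>) ^ k * c0_nth x k" for k
  have "z (Suc k) = z k + inverse (of_nat (Suc k)) / \<mu>" for k
  proof -
    have "w * c0_nth x (Suc k) = \<mu> * c0_nth x k + (\<mu> / w) ^ k * inverse (of_nat (Suc k))"
      using c0_nth_shift_minus[of w \<mu> x k] by (simp add: x nth_y algebra_simps)
    moreover have "z (Suc k) = (w / \<mu>) ^ k * (w * c0_nth x (Suc k)) / \<mu>"
      by (simp add: z_def)
    ultimately have "z (Suc k) = (w / \<mu>) ^ k * (\<mu> * c0_nth x k) / \<mu>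
        + ((w / \<mu>) ^ k * (\<mu> / w) ^ k) * inverse (of_nat (Suc k)) / \<mu>"
      by (simp add: distrib_left add_divide_distrib del: of_nat_Suc)
    moreover have "(w / \<mu>) ^ k * (\<mu> / w) ^ k = 1"
      using assms(1) \<open>\<mu> \<noteq> 0\<close> by (simp flip: power_mult_distrib)
    ultimately show ?thesis
      using \<open>\<mu> \<noteq> 0\<close> by (simp add: z_def del: of_nat_Suc)
  qed
  then have "z k - z 0 = harm k / \<mu>" for k
    by (induction k)
      (simp_all add: harm_expand(1) harm_Suc add_divide_distrib algebra_simps del: of_nat_Suc)
  then have harm_eq: "harm = (\<lambda>k. \<mu> * (z k - z 0))"
    using \<open>\<mu> \<noteq> 0\<close> by (simp add: fun_eq_iff)
  have "(\<lambda>k. norm (z k)) \<longlonglongrightarrow> 0"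
    using assms tendsto_norm_zero[OF c0_nth_tendsto[of x]]
    by (simp add: z_def norm_mult norm_power norm_divide)
  then have "z \<longlonglongrightarrow> 0"
    by (rule tendsto_norm_zero_cancel)
  then have "(\<lambda>k. \<mu> * (z k - z 0)) \<longlonglongrightarrow> \<mu> * (0 - z 0)"
    by (intro tendsto_intros)
  then have "convergent (harm :: nat \<Rightarrow> complex)"
    unfolding harm_eq by (rule convergentI)
  then show False
    using not_convergent_harm by blast
qed

lemma point_spectrum_backward_shift:
  assumes "w \<noteq> 0"
  shows "point_spectrum c0_scale UNIV (backward_shift w) = {\<mu>. norm \<mu> < norm w}"
  unfolding point_spectrum_def
  using not_inj_shift_minus inj_shift_minus[OF assms] by (auto simp flip: not_le)

lemma continuous_spectrum_backward_shift:
  assumes "w \<noteq> 0"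
  shows "continuous_spectrum c0_scale UNIV (backward_shift w) = {\<mu>. norm \<mu> = norm w}"
proof -
  have "inj (shift_minus w \<mu>) \<and> range (shift_minus w \<mu>) \<noteq> UNIV \<and>
      closure (range (shift_minus w \<mu>)) = UNIV \<longleftrightarrow> norm \<mu> = norm w" for \<mu>
  proof (cases "norm \<mu>" "norm w" rule: linorder_cases)
    case less
    then show ?thesis
      using not_inj_shift_minus by auto
  next
    case equal
    then have "\<mu> \<noteq> 0"
      using assms by auto
    with equal show ?thesis
      using inj_shift_minus[OF assms] not_surj_shift_minus[OF assms] range_shift_minus_dense
      by auto
  next
    case greater
    then show ?thesis
      using surj_shift_minus by auto
  qed
  then show ?thesis
    unfolding continuous_spectrum_def by blast
qed

lemma residual_spectrum_backward_shift:
  assumes "w \<noteq> 0"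
  shows "residual_spectrum c0_scale UNIV (backward_shift w) = {}"
proof -
  have "closure (range (shift_minus w \<mu>)) = UNIV" if "inj (shift_minus w \<mu>)" for \<mu>
  proof (rule range_shift_minus_dense)
    show "\<mu> \<noteq> 0"
      using that not_inj_shift_minus[of \<mu> w] assms by auto
  qed
  then show ?thesis
    unfolding residual_spectrum_def by blast
qed

lemma spectrum_backward_shift:
  assumes "w \<noteq> 0"
  shows "spectrum c0_scale UNIV (backward_shift w) = {\<mu>. norm \<mu> \<le> norm w}"
  unfolding spectrum_def point_spectrum_backward_shift[OF assms]
    continuous_spectrum_backward_shift[OF assms] residual_spectrum_backward_shift[OF assms]
  by auto

theorem theorem3p1:
  "(\<forall>w::real. norm w > 1 \<longrightarrow>
      bounded_linear_operator (backward_shift w) \<and>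
      chaotic UNIV (backward_shift w) \<and>
      (\<forall>n\<ge>1. chaotic UNIV (backward_shift w ^^ n))) \<and>
   (\<forall>w::complex. norm w > 1 \<longrightarrow>
      bounded_linear_operator (backward_shift w) \<and>
      chaotic UNIV (backward_shift w) \<and>
      (\<forall>n\<ge>1. chaotic UNIV (backward_shift w ^^ n)) \<and>
      spectrum c0_scale UNIV (backward_shift w) = {\<mu>. norm \<mu> \<le> norm w} \<and>
      point_spectrum c0_scale UNIV (backward_shift w) = {\<mu>. norm \<mu> < norm w} \<and>
      continuous_spectrum c0_scale UNIV (backward_shift w) = {\<mu>. norm \<mu> = norm w})"
proof (intro conjI allI impI)
  fix w :: real assume w: "norm w > 1"
  show "bounded_linear_operator (backward_shift w)"
    by (rule bounded_linear_operator_backward_shift)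
  show "chaotic UNIV (backward_shift w)"
    using w by (rule chaotic_backward_shift)
  show "chaotic UNIV (backward_shift w ^^ n)" if "n \<ge> 1" for n
    using w that by (rule chaotic_backward_shift_funpow)
next
  fix w :: complex assume w: "norm w > 1"
  then have "w \<noteq> 0" by auto
  show "bounded_linear_operator (backward_shift w)"
    by (rule bounded_linear_operator_backward_shift)
  show "chaotic UNIV (backward_shift w)"
    using w by (rule chaotic_backward_shift)
  show "chaotic UNIV (backward_shift w ^^ n)" if "n \<ge> 1" for n
    using w that by (rule chaotic_backward_shift_funpow)
  show "spectrum c0_scale UNIV (backward_shift w) = {\<mu>. norm \<mu> \<le> norm w}"
    using \<open>w \<noteq> 0\<close> by (rule spectrum_backward_shift)
  show "point_spectrum c0_scale UNIV (backward_shift w) = {\<mu>. norm \<mu> < norm w}"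
    using \<open>w \<noteq> 0\<close> by (rule point_spectrum_backward_shift)
  show "continuous_spectrum c0_scale UNIV (backward_shift w) = {\<mu>. norm \<mu> = norm w}"
    using \<open>w \<noteq> 0\<close> by (rule continuous_spectrum_backward_shift)
qed

end
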